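(* Let $n\ge1$ and let $(u,v,t)\in\mathcal R_n^3$ be a critical triple, i.e. $u\not\triangleleft v$ and $v\not\triangleleft t$. Then, after either of the two initial rewriting steps $$\alpha_{u,v}1_{r_t}\colon r_ur_vr_t\Rightarrow\mathcal R(N(uv))\,r_t,\qquad 1_{r_u}\alpha_{v,t}\colon r_ur_vr_t\Rightarrow r_u\,\mathcal R(N(vt))$$ (called the left and right branch, respectively), the resulting word reaches the normal form $\operatorname{NF}(u,v,t):=\mathcal R(N(uvt))$ in at most two further rewriting steps of $\Sigma^{\mathrm{row}}(n)$. Moreover: (i) the normal form $\operatorname{NF}(u,v,t)$ has at most three rows (i.e. is a product of at most three generators $r_w$); (ii) if $N(uv)$ has one row, then the left branch reaches the normal form in exactly one further step; (iii) if $N(vt)$ has one row, then the right branch reaches the normal form in at most one further step; (iv) if both $N(uv)$ and $N(vt)$ have one row, then the normal form has one row.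
   Context: Fix $n\geq1$, $[n]=\{1<2<\cdots<n\}$. For a word $w$ over $[n]$, $\mathrm{supp}(w)$ is its set of letters. A row is a nonempty strictly increasing word over $[n]$, identified with its support; $\mathcal R_n$ is the set of rows. For rows $u,v$, $u\triangleleft v$ means $\mathrm{supp}(u)\subseteq\mathrm{supp}(v)$ and $\min(v)<\min(u)$. An $N$-tableau $T$ is a finite sequence of rows $u_k,\dots,u_1$ (top to bottom) with $u_{i+1}\triangleleft u_i$ for all $i$; $\mathcal R(T):=r_{u_k}\cdots r_{u_1}$ is its row-generator reading. Right $N$-insertion of a letter $x$: insert $x$ in the bottom row $u_1$, i.e. replace $u_1$ by the row with support $\mathrm{supp}(u_1)\cup\{x\}$; if $u_1$ has a letter $>x$, the smallest such letter $y$ is bumped (it also stays in the row) and is inserted in the same way into the next row above, and so on; a letter bumped from the top row creates a new top row consisting of that letter. For a word $w$, $N(w)$ is obtained by inserting its letters from left to right starting from the empty tableau (inserting $x$ in the empty tableau gives the one-row tableau $x$). For rows $u,v$, $N(uv)$ has at most two rows. $\Sigma^{\mathrm{row}}(n)$ is the rewriting system on words in the symbols $r_u$, $u\in\mathcal R_n$, with rules $\alpha_{u,v}\colon r_ur_v\Rightarrow\mathcal R(N(uv))$ for all rows $u,v$ with $u\not\triangleleft v$. A rewriting step is the application of one rule to a factor of a word. The system is known to be convergent, its normal forms being the words $\mathcal R(T)$, $T$ an $N$-tableau; $\mathcal R(N(uvt))$ is the normal form of $r_ur_vr_t$. *)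

theory Defs
  imports Main
begin

text \<open>
  Words over \<open>[n] = {1..n}\<close> are lists of natural numbers, and a row is represented by its
  strictly increasing word, so that concatenations of rows can be inserted letter by letter.
\<close>

type_synonym row = "nat list"

definition rows :: "nat \<Rightarrow> row set" where
  "rows n = {u. u \<noteq> [] \<and> sorted_wrt (<) u \<and> set u \<subseteq> {1..n}}"

definition row_rel :: "row \<Rightarrow> row \<Rightarrow> bool" (infix "\<triangleleft>" 50) where
  "u \<triangleleft> v \<longleftrightarrow> set u \<subseteq> set v \<and> Min (set v) < Min (set u)"

text \<open>
  A tableau \<open>u\<^sub>k, \<dots>, u\<^sub>1\<close> (top to bottom) is stored bottom row first, as the
  list \<open>[u\<^sub>1, \<dots>, u\<^sub>k]\<close>; insertion then recurses along the list.
\<close>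

type_synonym tableau = "row list"

definition N_tableau :: "nat \<Rightarrow> tableau \<Rightarrow> bool" where
  "N_tableau n T \<longleftrightarrow>
     set T \<subseteq> rows n \<and> (\<forall>i. Suc i < length T \<longrightarrow> T ! Suc i \<triangleleft> T ! i)"

definition add_letter :: "nat \<Rightarrow> row \<Rightarrow> row" where
  "add_letter x u = sorted_list_of_set (insert x (set u))"

text \<open>
  A letter bumped from the top row reaches the empty list, where it creates a new row.
  The bumped letter is not removed from the row it is bumped from.
\<close>

fun N_insert :: "nat \<Rightarrow> tableau \<Rightarrow> tableau" where
  "N_insert x [] = [[x]]"
| "N_insert x (u # T) =
     add_letter x u #
       (if \<exists>y\<in>set u. x < y then N_insert (Min {y \<in> set u. x < y}) T else T)"

definition N :: "nat list \<Rightarrow> tableau" where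
  "N w = fold N_insert w []"

datatype generator = Gen row

definition reading :: "tableau \<Rightarrow> generator list" where
  "reading T = map Gen (rev T)"

definition row_rules :: "nat \<Rightarrow> (generator list \<times> generator list) set" where
  "row_rules n =
     {([Gen u, Gen v], reading (N (u @ v))) |u v. u \<in> rows n \<and> v \<in> rows n \<and> \<not> u \<triangleleft> v}"

definition row_step :: "nat \<Rightarrow> (generator list \<times> generator list) set" where
  "row_step n =
     {(a @ l @ b, a @ r @ b) |a l r b.
        a \<in> lists (Gen ` rows n) \<and> b \<in> lists (Gen ` rows n) \<and> (l, r) \<in> row_rules n}"

definition NF :: "row \<Rightarrow> row \<Rightarrow> row \<Rightarrow> generator list" where
  "NF u v t = reading (N (u @ v @ t))"


text \<open>The results of the two initial rewriting steps starting from \<open>r\<^sub>u r\<^sub>v r\<^sub>t\<close>.\<close>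

definition left_branch :: "row \<Rightarrow> row \<Rightarrow> row \<Rightarrow> generator list" where
  "left_branch u v t = reading (N (u @ v)) @ [Gen t]"

definition right_branch :: "row \<Rightarrow> row \<Rightarrow> row \<Rightarrow> generator list" where
  "right_branch u v t = [Gen u] @ reading (N (v @ t))"


subsection \<open>Readings of tableaux obtained by insertion are irreducible\<close>

text \<open>
  This justifies calling \<^term>\<open>NF u v t\<close> a normal form. In particular, a word
  that reaches it in one step does not already equal it.
\<close>

lemma N_tableau_Cons:
  "N_tableau n (u # T) \<longleftrightarrow>
     u \<in> rows n \<and> N_tableau n T \<and> (T \<noteq> [] \<longrightarrow> hd T \<triangleleft> u)"
  unfolding N_tableau_def
  by (cases T) (auto simp: nth_Cons split: nat.splits)

lemma set_add_letter [simp]: "set (add_letter x u) = insert x (set u)"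
  unfolding add_letter_def by (rule set_sorted_list_of_set) simp

lemma add_letter_rows:
  assumes "u \<in> rows n" "x \<in> {1..n}"
  shows "add_letter x u \<in> rows n"
proof -
  have "sorted_wrt (<) (add_letter x u)"
    unfolding add_letter_def by (rule strict_sorted_list_of_set)
  moreover have "add_letter x u \<noteq> []"
    using set_add_letter[of x u] by (metis insert_not_empty list.set(1))
  ultimately show ?thesis
    using assms by (simp add: rows_def)
qed

lemma row_rel_iff:
  assumes "set u \<noteq> {}" "set v \<noteq> {}"
  shows "u \<triangleleft> v \<longleftrightarrow> set u \<subseteq> set v \<and> (\<exists>y\<in>set v. \<forall>z\<in>set u. y < z)"
proof -
  have "Min (set v) < Min (set u) \<longleftrightarrow> (\<exists>y\<in>set v. y < Min (set u))"
    using assms by (intro Min_less_iff) auto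
  also have "\<dots> \<longleftrightarrow> (\<exists>y\<in>set v. \<forall>z\<in>set u. y < z)"
    using assms by (intro bex_cong refl Min_gr_iff) auto
  finally show ?thesis by (simp add: row_rel_def)
qed

lemma N_insert_neq_Nil [simp]: "N_insert x T \<noteq> []"
  by (cases T) auto

lemma set_hd_N_insert: "set (hd (N_insert x T)) = insert x (if T = [] then {} else set (hd T))"
  by (cases T) auto

lemma N_tableau_N_insert:
  assumes "N_tableau n T" "x \<in> {1..n}"
  shows "N_tableau n (N_insert x T)"
  using assms
proof (induction T arbitrary: x)
  case Nil
  then show ?case by (simp add: N_tableau_def rows_def)
next
  case (Cons u T)
  have u: "u \<in> rows n" and T: "N_tableau n T" and hd: "T \<noteq> [] \<Longrightarrow> hd T \<triangleleft> u"
    using Cons.prems(1) by (auto simp: N_tableau_Cons)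
  have row: "add_letter x u \<in> rows n"
    using add_letter_rows u Cons.prems(2) by blast
  have une: "set u \<noteq> {}" using u by (simp add: rows_def)
  have Tne: "set (hd T) \<noteq> {}" if "T \<noteq> []"
    using T that by (cases T) (auto simp: N_tableau_Cons rows_def)
  show ?case
  proof (cases "\<exists>y\<in>set u. x < y")
    case True
    define y where "y = Min {y \<in> set u. x < y}"
    have "y \<in> {y \<in> set u. x < y}"
      unfolding y_def using True by (intro Min_in) auto
    then have y: "y \<in> set u" "x < y" by auto
    have "y \<in> {1..n}" using y(1) u by (auto simp: rows_def)
    then have IH: "N_tableau n (N_insert y T)" by (rule Cons.IH[OF T])
    have "hd (N_insert y T) \<triangleleft> add_letter x u"
    proof (cases "T = []")
      case True
      then show ?thesis
        using y by (subst row_rel_iff) (auto simp: set_hd_N_insert)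
    next
      case False
      then have sub: "set (hd T) \<subseteq> set u" and "\<exists>a\<in>set u. \<forall>z\<in>set (hd T). a < z"
        using hd[OF False] row_rel_iff[OF Tne[OF False] une] by auto
      then obtain a where a: "a \<in> set u" "\<forall>z\<in>set (hd T). a < z" by blast
      have *: "min a x \<in> insert x (set u)" "\<forall>z\<in>insert y (set (hd T)). min a x < z"
        using a y by (auto simp: min_def)
      show ?thesis
        using False sub y(1) *
        by (subst row_rel_iff) (auto simp: set_hd_N_insert simp del: min_less_iff_conj)
    qed
    then show ?thesis
      using True IH row by (simp add: N_tableau_Cons y_def)
  next
    case False
    have "hd T \<triangleleft> add_letter x u" if "T \<noteq> []"
      using hd[OF that] une Tne[OF that] by (auto simp: row_rel_iff)
    then show ?thesis
      using False T row by (auto simp: N_tableau_Cons)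
  qed
qed

lemma N_tableau_N: "set w \<subseteq> {1..n} \<Longrightarrow> N_tableau n (N w)"
proof (induction w rule: rev_induct)
  case Nil
  then show ?case by (simp add: N_def N_tableau_def)
next
  case (snoc x w)
  then show ?case by (simp add: N_def N_tableau_N_insert)
qed

lemma reading_irreducible:
  assumes "N_tableau n T"
  shows "(reading T, w) \<notin> row_step n"
proof
  assume "(reading T, w) \<in> row_step n"
  then obtain a b u v where eq: "map Gen (rev T) = a @ [Gen u, Gen v] @ b" and "\<not> u \<triangleleft> v"
    unfolding row_step_def row_rules_def reading_def by auto
  from arg_cong[OF eq, of rev] have eq': "map Gen T = rev b @ Gen v # Gen u # rev a"
    by (simp add: rev_map)
  then have len: "Suc (length b) < length T"
    by (metis add_Suc_right length_Cons length_append length_map length_rev less_add_Suc1 add_Suc)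
  have "Gen (T ! length b) = Gen v"
    using arg_cong[OF eq', of "\<lambda>xs. xs ! length b"] len by (simp add: nth_append)
  moreover have "Gen (T ! Suc (length b)) = Gen u"
    using arg_cong[OF eq', of "\<lambda>xs. xs ! Suc (length b)"] len by (simp add: nth_append)
  ultimately show False
    using assms len \<open>\<not> u \<triangleleft> v\<close> by (auto simp: N_tableau_def)
qed

lemma NF_irreducible:
  assumes "u \<in> rows n" "v \<in> rows n" "t \<in> rows n"
  shows "(NF u v t, w) \<notin> row_step n"
  unfolding NF_def
  using assms by (intro reading_irreducible N_tableau_N) (auto simp: rows_def)

end

theory Submission
  imports Defs
begin

text \<open>
  Inserting a weakly increasing word with support \<open>S\<close> into a row with support \<open>A\<close> yields the row
  \<open>A \<union> S\<close> and bumps, in weakly increasing order, the successors in \<open>A\<close> of the letters of \<open>S\<close>, which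
  form the set \<open>bump A S\<close>. A rewriting step thus sends \<open>(A, B)\<close> to \<open>(bump A B, A \<union> B)\<close>, an empty
  row being read as the empty word; if \<open>A \<triangleleft> B\<close> then \<open>bump A B = A\<close>, so that nothing changes.
  The left branch reproduces the insertion of \<open>t\<close> in \<open>N(uv)\<close> row by row. For the right branch put
  \<open>s = bump v t\<close>; the claim amounts to the two identities
  \<open>bump (u \<union> s) (v \<union> t) = bump u v \<union> bump (u \<union> v) t\<close> and
  \<open>bump u s = bump (bump u v) (bump (u \<union> v) t)\<close>.
\<close>

section \<open>Successors in a set and the bumped set\<close>

definition succ_in :: "nat set \<Rightarrow> nat \<Rightarrow> nat \<Rightarrow> bool" where
  "succ_in A x y \<longleftrightarrow> y \<in> A \<and> x < y \<and> (\<forall>w\<in>A. x < w \<longrightarrow> y \<le> w)"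

definition bump :: "nat set \<Rightarrow> nat set \<Rightarrow> nat set" where
  "bump A S = {y. \<exists>x\<in>S. succ_in A x y}"

lemma succ_in_unique: "succ_in A x y \<Longrightarrow> succ_in A x z \<Longrightarrow> y = z"
  by (auto simp: succ_in_def intro: antisym)

lemma succ_in_exists:
  assumes "y \<in> A" "x < y"
  obtains z where "succ_in A x z" "z \<le> y"
proof
  let ?z = "LEAST z. z \<in> A \<and> x < z"
  show "succ_in A x ?z"
    unfolding succ_in_def using LeastI[of "\<lambda>z. z \<in> A \<and> x < z"] assms
    by (auto intro: Least_le)
  show "?z \<le> y" using assms by (auto intro: Least_le)
qed

lemma succ_in_Min:
  assumes "finite A" "y \<in> A" "x < y"
  shows "succ_in A x (Min {y \<in> A. x < y})"
proof -
  have "Min {y \<in> A. x < y} \<in> {y \<in> A. x < y}" using assms by (intro Min_in) auto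
  then show ?thesis using assms(1) by (auto simp: succ_in_def)
qed

lemma bump_subset: "bump A S \<subseteq> A"
  by (auto simp: bump_def succ_in_def)

lemma bump_empty [simp]: "bump {} S = {}" "bump A {} = {}"
  by (auto simp: bump_def succ_in_def)

lemma finite_bump [simp]: "finite A \<Longrightarrow> finite (bump A S)"
  using bump_subset finite_subset by blast

lemma bump_insert:
  "bump A (insert x S) = {y. succ_in A x y} \<union> bump A S"
  by (auto simp: bump_def)

text \<open>A letter \<open>x\<close> that exceeds no letter of \<open>S\<close> is neither a
  successor of one nor a competitor for it. This lets an induction along a weakly increasing word
  ignore the letters already inserted.\<close>

lemma bump_insert_le:
  assumes "\<forall>s\<in>S. x \<le> s"
  shows "bump (insert x A) S = bump A S"
  using assms by (fastforce simp: bump_def succ_in_def)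

lemma bump_eq_empty_iff: "bump A S = {} \<longleftrightarrow> (\<forall>a\<in>A. \<forall>s\<in>S. a \<le> s)"
proof
  show "\<forall>a\<in>A. \<forall>s\<in>S. a \<le> s" if "bump A S = {}"
  proof (intro ballI leI notI)
    fix a s assume "a \<in> A" "s \<in> S" "s < a"
    then obtain z where "succ_in A s z" by (blast elim: succ_in_exists)
    then show False using that \<open>s \<in> S\<close> by (auto simp: bump_def)
  qed
qed (fastforce simp: bump_def succ_in_def)

text \<open>Each \<open>a\<close> is the successor in \<open>A\<close> of the largest element of
  \<open>B\<close> below \<open>a\<close>: that element exists because of \<open>b\<close>, and
  nothing of \<open>A\<close> lies in between because \<open>A \<subseteq> B\<close>.\<close>

lemma bump_row_rel:
  assumes "A \<subseteq> B" "b \<in> B" "\<forall>a\<in>A. b < a"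
  shows "bump A B = A"
proof (rule antisym[OF bump_subset], rule subsetI)
  fix a assume a: "a \<in> A"
  let ?x = "Max {x \<in> B. x < a}"
  have fin: "finite {x \<in> B. x < a}" by (rule finite_subset[of _ "{..<a}"]) auto
  have x: "?x \<in> {x \<in> B. x < a}" using assms a by (intro Max_in fin) auto
  have "succ_in A ?x a"
    unfolding succ_in_def
  proof (intro conjI ballI impI)
    fix w assume w: "w \<in> A" "?x < w"
    show "a \<le> w"
    proof (rule ccontr)
      assume "\<not> a \<le> w"
      then have "w \<le> ?x" using w assms(1) by (intro Max_ge fin) auto
      then show False using w by simp
    qed
  qed (use a x in auto)
  then show "a \<in> bump A B" using x by (auto simp: bump_def)
qed

section \<open>The two identities comparing the branches\<close>

lemma bump_Un_bump:
  "bump (u \<union> bump v t) (v \<union> t) = bump u v \<union> bump (u \<union> v) t"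
proof (intro antisym subsetI)
  fix a assume "a \<in> bump (u \<union> bump v t) (v \<union> t)"
  then obtain x where x: "x \<in> v \<union> t" and xa: "succ_in (u \<union> bump v t) x a"
    by (auto simp: bump_def)
  \<comment> \<open>No element of \<open>v\<close> can lie between \<open>x\<close> and
    \<open>a\<close>: the successor of \<open>x\<close> in \<open>v\<close> belongs to
    \<open>bump v t\<close> and is at most as large.\<close>
  have t: "succ_in (u \<union> v) x a" if "x \<in> t"
    unfolding succ_in_def
  proof (intro conjI ballI impI)
    show "a \<in> u \<union> v" "x < a" using xa bump_subset by (auto simp: succ_in_def)
    fix w assume w: "w \<in> u \<union> v" "x < w"
    show "a \<le> w"
    proof (cases "w \<in> u")
      case True
      then show ?thesis using xa w by (auto simp: succ_in_def)
    next
      case False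
      then obtain z where z: "succ_in v x z" "z \<le> w" using w by (auto elim: succ_in_exists)
      then have "z \<in> bump v t" using that by (auto simp: bump_def)
      then show ?thesis using xa z by (fastforce simp: succ_in_def)
    qed
  qed
  have v: "a \<in> bump u v \<union> bump (u \<union> v) t" if xv: "x \<in> v"
  proof (cases "a \<in> u")
    case True
    then have "succ_in u x a" using xa by (auto simp: succ_in_def)
    then show ?thesis using xv by (auto simp: bump_def)
  next
    case False
    then have "a \<in> bump v t" using xa by (auto simp: succ_in_def)
    then obtain y where y: "y \<in> t" "succ_in v y a" by (auto simp: bump_def)
    \<comment> \<open>No element of \<open>v\<close> lies strictly between \<open>y\<close> and
      \<open>a\<close>, and \<open>x\<close> is below \<open>a\<close>. Since \<open>u\<close> has
      no element between \<open>x\<close> and \<open>a\<close>, it then has none between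
      \<open>y\<close> and \<open>a\<close>.\<close>
    have "x \<le> y" using y(2) xv xa by (force simp: succ_in_def)
    then have "succ_in (u \<union> v) y a" using y(2) xa by (auto simp: succ_in_def)
    then show ?thesis using y(1) by (auto simp: bump_def)
  qed
  show "a \<in> bump u v \<union> bump (u \<union> v) t"
    using x v t by (auto simp: bump_def)
next
  fix a assume "a \<in> bump u v \<union> bump (u \<union> v) t"
  then consider x where "x \<in> v" "succ_in u x a" | y where "y \<in> t" "succ_in (u \<union> v) y a"
    by (auto simp: bump_def)
  then show "a \<in> bump (u \<union> bump v t) (v \<union> t)"
  proof cases
    case (1 x)
    \<comment> \<open>Between \<open>x\<close> and \<open>a\<close> there may be an element of
      \<open>bump v t\<close>. Replacing \<open>x\<close> by the largest letter of \<open>v\<close>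
      below \<open>a\<close> excludes this, and its successor in \<open>u\<close> is still
      \<open>a\<close>.\<close>
    let ?m = "Max {x \<in> v. x < a}"
    have fin: "finite {x \<in> v. x < a}" by (rule finite_subset[of _ "{..<a}"]) auto
    have xin: "x \<in> {x \<in> v. x < a}" using 1 by (auto simp: succ_in_def)
    have m: "?m \<in> {x \<in> v. x < a}" using xin by (intro Max_in fin) auto
    have "x \<le> ?m" using xin by (intro Max_ge fin)
    have no_v: "a \<le> w" if "w \<in> v" "?m < w" for w
    proof (rule ccontr)
      assume "\<not> a \<le> w"
      then have "w \<le> ?m" using that by (intro Max_ge fin) auto
      then show False using that by simp
    qed
    have "succ_in (u \<union> bump v t) ?m a"
      unfolding succ_in_def
    proof (intro conjI ballI impI)
      show "a \<in> u \<union> bump v t" "?m < a" using 1 m by (auto simp: succ_in_def)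
      fix w assume w: "w \<in> u \<union> bump v t" "?m < w"
      show "a \<le> w"
      proof (cases "w \<in> u")
        case True
        have "x < w" using \<open>x \<le> ?m\<close> w(2) by simp
        then show ?thesis using 1(2) True by (auto simp: succ_in_def)
      next
        case False
        then show ?thesis using w bump_subset no_v by blast
      qed
    qed
    then show ?thesis using m by (auto simp: bump_def)
  next
    case (2 y)
    have "a \<in> bump v t" if "a \<notin> u"
      using 2 that by (auto simp: bump_def succ_in_def)
    then have "succ_in (u \<union> bump v t) y a"
      using 2 bump_subset[of v t] by (auto simp: succ_in_def)
    then show ?thesis using 2(1) by (auto simp: bump_def)
  qed
qed

text \<open>The routes from \<open>y\<close> to \<open>a\<close> through \<open>z\<close> (right
  branch) and through \<open>d\<close> (left branch) agree. A competitor \<open>b < a\<close>,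
  bumped by some \<open>x\<close> in \<open>v\<close>, would give
  \<open>y < d \<le> x < b \<le> z\<close>, so \<open>z\<close> would not be the successor of
  \<open>y\<close> in \<open>v\<close>.\<close>

lemma succ_in_bump:
  assumes "succ_in v y z" "succ_in u z a" "succ_in (u \<union> v) y d"
  shows "succ_in (bump u v) d a"
  unfolding succ_in_def
proof (intro conjI ballI impI)
  have d: "d \<le> z" using assms by (auto simp: succ_in_def)
  show "a \<in> bump u v" using assms by (auto simp: bump_def succ_in_def)
  show "d < a" using d assms(2) by (auto simp: succ_in_def)
  fix b assume b: "b \<in> bump u v" "d < b"
  then obtain x where x: "x \<in> v" "succ_in u x b" by (auto simp: bump_def)
  show "a \<le> b"
  proof (rule ccontr)
    assume "\<not> a \<le> b"
    then have "b \<le> z" using x assms(2) by (force simp: succ_in_def)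
    then have "d \<noteq> z" using b(2) by simp
    then have "d \<in> u" using assms d by (force simp: succ_in_def)
    then have "d \<le> x" using x b(2) by (force simp: succ_in_def)
    moreover have "y < d" using assms(3) by (auto simp: succ_in_def)
    moreover have "x < z" using x \<open>b \<le> z\<close> by (auto simp: succ_in_def)
    ultimately show False using assms(1) x(1) by (force simp: succ_in_def)
  qed
qed

text \<open>For a fixed \<open>y\<close> in \<open>t\<close>, both sides follow the two routes of
  \<open>succ_in_bump\<close>; what remains is that each route exists whenever the other
  does.\<close>

lemma bump_bump:
  "bump u (bump v t) = bump (bump u v) (bump (u \<union> v) t)"
proof (intro antisym subsetI)
  fix a assume "a \<in> bump u (bump v t)"
  then obtain y z where yz: "y \<in> t" "succ_in v y z" "succ_in u z a"
    by (auto simp: bump_def)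
  then have "z \<in> u \<union> v" "y < z" by (auto simp: succ_in_def)
  then obtain d where "succ_in (u \<union> v) y d" by (rule succ_in_exists)
  with yz succ_in_bump show "a \<in> bump (bump u v) (bump (u \<union> v) t)"
    by (fastforce simp: bump_def[of _ t] bump_def[of "bump u v"])
next
  fix e assume "e \<in> bump (bump u v) (bump (u \<union> v) t)"
  then obtain y d where y: "y \<in> t" and d: "succ_in (u \<union> v) y d" and e: "succ_in (bump u v) d e"
    by (auto simp: bump_def[of _ t] bump_def[of "bump u v"])
  then have "e \<in> bump u v" and "d < e" by (auto simp: succ_in_def)
  then obtain x where x: "x \<in> v" "succ_in u x e" by (auto simp: bump_def)
  \<comment> \<open>Keeping \<open>z\<close> below \<open>e\<close> ensures that \<open>z\<close>
    has a successor in \<open>u\<close>. If \<open>d\<close> is not in \<open>v\<close>, then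
    \<open>d \<le> x\<close>, as otherwise \<open>d\<close> would come before \<open>e\<close> among
    the elements of \<open>u\<close> above \<open>x\<close>; hence
    \<open>z \<le> x < e\<close>.\<close>
  obtain z where z: "succ_in v y z" "z < e"
  proof (cases "d \<in> v")
    case True
    then have "succ_in v y d" using d by (auto simp: succ_in_def)
    then show ?thesis using that \<open>d < e\<close> by blast
  next
    case False
    then have "d \<in> u" "y < d" using d by (auto simp: succ_in_def)
    then have "y < x" using x(2) \<open>d < e\<close> by (force simp: succ_in_def)
    with x(1) obtain z where "succ_in v y z" "z \<le> x" by (rule succ_in_exists)
    then show ?thesis using that x(2) by (auto simp: succ_in_def)
  qed
  have "e \<in> u" using x(2) by (auto simp: succ_in_def)
  from this z(2) obtain a where a: "succ_in u z a" by (rule succ_in_exists)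
  have "a = e" using succ_in_unique[OF succ_in_bump[OF z(1) a d] e] .
  then show "e \<in> bump u (bump v t)" using y z(1) a by (auto simp: bump_def)
qed

section \<open>Insertion of sorted words in terms of sets\<close>

definition row_word :: "nat set \<Rightarrow> tableau" where
  "row_word A = (if A = {} then [] else [sorted_list_of_set A])"

definition gens :: "nat set \<Rightarrow> generator list" where
  "gens A = map Gen (row_word A)"

lemma reading_Nil [simp]: "reading [] = []"
  by (simp add: reading_def)

lemma reading_row_word: "reading (row_word A @ T) = reading T @ gens A"
  by (auto simp: reading_def gens_def row_word_def)

lemma gens_empty [simp]: "gens {} = []"
  by (simp add: gens_def row_word_def)

lemma length_gens_le: "length (gens A) \<le> 1"
  by (simp add: gens_def row_word_def)

lemma rows_sorted: "u \<in> rows n \<Longrightarrow> sorted u"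
  by (auto simp: rows_def intro: sorted_wrt_mono_rel[of _ "(<)" "(\<le>)"])

lemma rows_eq: "u \<in> rows n \<Longrightarrow> sorted_list_of_set (set u) = u"
  by (auto simp: rows_def strict_sorted_iff intro: sorted_list_of_set.idem_if_sorted_distinct)

lemma sorted_list_of_set_rows:
  assumes "A \<noteq> {}" "A \<subseteq> {1..n}"
  shows "sorted_list_of_set A \<in> rows n"
  using assms finite_subset[OF assms(2)] by (auto simp: rows_def)

lemma gens_row: "u \<in> rows n \<Longrightarrow> gens (set u) = [Gen u]"
  using rows_eq[of u n] by (auto simp: gens_def row_word_def rows_def)

lemma gens_lists: "A \<subseteq> {1..n} \<Longrightarrow> gens A \<in> lists (Gen ` rows n)"
  using sorted_list_of_set_rows by (auto simp: gens_def row_word_def)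

text \<open>Several letters may bump the same letter of \<open>A\<close>, so \<open>w'\<close> can
  have repetitions. Only its order and its support are recorded, which suffices to apply the lemma
  again to the next row.\<close>

lemma fold_N_insert_Cons:
  assumes "sorted w" "finite A"
  shows "\<exists>w'. sorted w' \<and> set w' = bump A (set w) \<and>
    fold N_insert w (sorted_list_of_set A # T) =
      sorted_list_of_set (A \<union> set w) # fold N_insert w' T"
  using assms
proof (induction w arbitrary: A T)
  case Nil
  then show ?case by (intro exI[of _ "[]"]) simp
next
  case (Cons x w)
  have le: "\<forall>s\<in>set w. x \<le> s" and w: "sorted w" using Cons.prems by auto
  have add: "add_letter x (sorted_list_of_set A) = sorted_list_of_set (insert x A)"
    using Cons.prems by (simp add: add_letter_def)
  have fin: "finite (insert x A)" using Cons.prems by simp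
  \<comment> \<open>Stated for every \<open>T'\<close>, since a bumped letter changes the upper rows
    before \<open>w\<close> is inserted. By \<open>bump_insert_le\<close> the bumped set is still
    computed in \<open>A\<close>.\<close>
  have IH: "\<exists>w'. sorted w' \<and> set w' = bump A (set w) \<and>
    fold N_insert w (sorted_list_of_set (insert x A) # T') =
      sorted_list_of_set (insert x A \<union> set w) # fold N_insert w' T'" for T'
    using Cons.IH[OF w fin, of T'] unfolding bump_insert_le[OF le] .
  have Un: "insert x A \<union> set w = A \<union> set (x # w)" by auto
  show ?case
  proof (cases "\<exists>y\<in>A. x < y")
    case True
    define y where "y = Min {y \<in> A. x < y}"
    have y: "succ_in A x y"
      using True Cons.prems succ_in_Min unfolding y_def by blast
    obtain w' where w': "sorted w'" "set w' = bump A (set w)"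
      "fold N_insert w (sorted_list_of_set (insert x A) # N_insert y T) =
        sorted_list_of_set (insert x A \<union> set w) # fold N_insert w' (N_insert y T)"
      using IH by blast
    \<comment> \<open>Later letters are at least \<open>x\<close>, so their successors are at least
      \<open>y\<close>; the bumped word remains sorted with \<open>y\<close> in front.\<close>
    have "\<forall>z\<in>set w'. y \<le> z"
      unfolding w'(2) using y le by (fastforce simp: bump_def succ_in_def)
    then have "sorted (y # w')" using w'(1) by simp
    moreover have "{y. succ_in A x y} = {y}" using y succ_in_unique by blast
    then have "set (y # w') = bump A (set (x # w))" using w'(2) by (simp add: bump_insert)
    moreover have "N_insert x (sorted_list_of_set A # T) =
        sorted_list_of_set (insert x A) # N_insert y T"
      using True Cons.prems(2) by (simp add: add y_def)
    then have "fold N_insert (x # w) (sorted_list_of_set A # T) =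
        sorted_list_of_set (A \<union> set (x # w)) # fold N_insert (y # w') T"
      using w'(3) Un by simp
    ultimately show ?thesis by blast
  next
    case False
    then have "{y. succ_in A x y} = {}" by (auto simp: succ_in_def)
    then have "bump A (set (x # w)) = bump A (set w)" by (simp add: bump_insert)
    moreover have "N_insert x (sorted_list_of_set A # T) = sorted_list_of_set (insert x A) # T"
      using False Cons.prems(2) by (simp add: add)
    then have "fold N_insert (x # w) (sorted_list_of_set A # T) =
        fold N_insert w (sorted_list_of_set (insert x A) # T)" by simp
    ultimately show ?thesis using IH[of T] unfolding Un by simp
  qed
qed

lemma fold_N_insert_Nil:
  assumes "sorted w"
  shows "fold N_insert w [] = row_word (set w)"
proof (cases w)
  case (Cons x w1)
  \<comment> \<open>The first letter creates a row, and the others, being at least \<open>x\<close>,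
    bump nothing from it.\<close>
  then have "bump {x} (set w1) = {}"
    using assms by (simp add: bump_eq_empty_iff)
  moreover have "sorted w1" using assms Cons by simp
  ultimately show ?thesis
    using fold_N_insert_Cons[of w1 "{x}" "[]"] Cons by (simp add: row_word_def)
qed (simp add: row_word_def)

text \<open>For empty \<open>A\<close> the list \<open>row_word A\<close> vanishes and the letters
  would enter \<open>T\<close> itself; hence nothing may stand above an empty row.\<close>

lemma fold_N_insert_row_word:
  assumes "sorted w" "finite A" "A = {} \<Longrightarrow> T = []"
  obtains w' where "sorted w'" "set w' = bump A (set w)"
    "fold N_insert w (row_word A @ T) = row_word (A \<union> set w) @ fold N_insert w' T"
proof (cases "A = {}")
  case True
  then show ?thesis
    using that[of "[]"] assms fold_N_insert_Nil[of w] by (simp add: row_word_def)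
next
  case False
  then show ?thesis
    using that fold_N_insert_Cons[OF assms(1,2), of T] by (auto simp: row_word_def)
qed

lemma N_append2:
  assumes "sorted u" "sorted v"
  shows "N (u @ v) = row_word (set u \<union> set v) @ row_word (bump (set u) (set v))"
proof -
  obtain w where "sorted w" "set w = bump (set u) (set v)"
    "fold N_insert v (row_word (set u) @ []) = row_word (set u \<union> set v) @ fold N_insert w []"
    using fold_N_insert_row_word[of v "set u" "[]"] assms by auto
  then show ?thesis using assms by (simp add: N_def fold_N_insert_Nil)
qed

text \<open>Inserting \<open>t\<close> into the bottom row of \<open>N (u @ v)\<close> bumps a word
  with support \<open>r\<close>; inserting that into the second row \<open>q\<close> bumps
  \<open>bump q r\<close>, which forms the top row.\<close>

lemma N_append3:
  assumes "sorted u" "sorted v" "sorted t"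
  defines "q \<equiv> bump (set u) (set v)"
    and "r \<equiv> bump (set u \<union> set v) (set t)"
  shows "N (u @ v @ t) =
    row_word (set u \<union> set v \<union> set t) @ row_word (q \<union> r) @ row_word (bump q r)"
proof -
  have "N (u @ v @ t) = fold N_insert t (N (u @ v))" by (simp add: N_def)
  also have "\<dots> = fold N_insert t (row_word (set u \<union> set v) @ row_word q)"
    using assms by (simp add: N_append2)
  finally have N: "N (u @ v @ t) = \<dots>" .
  obtain w where w: "sorted w" "set w = r"
    "fold N_insert t (row_word (set u \<union> set v) @ row_word q) =
      row_word (set u \<union> set v \<union> set t) @ fold N_insert w (row_word q)"
    using fold_N_insert_row_word[of t "set u \<union> set v" "row_word q"] assms
    by (auto simp: row_word_def)
  obtain w' where "sorted w'" "set w' = bump q r"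
    "fold N_insert w (row_word q @ []) = row_word (q \<union> r) @ fold N_insert w' []"
    using fold_N_insert_row_word[of w q "[]"] w assms by (auto simp: q_def)
  then show ?thesis using N w by (simp add: fold_N_insert_Nil)
qed

section \<open>Rewriting steps in terms of sets\<close>

lemma reading_N_append2:
  assumes "u \<in> rows n" "v \<in> rows n"
  shows "reading (N (u @ v)) = gens (bump (set u) (set v)) @ gens (set u \<union> set v)"
  using assms reading_row_word[of _ "[]"]
  by (simp add: N_append2 rows_sorted reading_row_word)

lemma row_step_gens:
  assumes "u \<in> rows n" "v \<in> rows n" "\<not> u \<triangleleft> v"
    and "a \<in> lists (Gen ` rows n)" "b \<in> lists (Gen ` rows n)"
  shows "(a @ [Gen u, Gen v] @ b,
    a @ gens (bump (set u) (set v)) @ gens (set u \<union> set v) @ b) \<in> row_step n"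
proof -
  have "([Gen u, Gen v], reading (N (u @ v))) \<in> row_rules n"
    using assms(1-3) unfolding row_rules_def by blast
  then have "(a @ [Gen u, Gen v] @ b, a @ reading (N (u @ v)) @ b) \<in> row_step n"
    using assms(4,5) unfolding row_step_def by blast
  then show ?thesis by (simp add: reading_N_append2[OF assms(1,2)])
qed

text \<open>The reflexive closure absorbs the degenerate cases: an empty set contributes no
  generator, and by \<open>bump_row_rel\<close> an irreducible pair is left unchanged.\<close>

lemma row_step_gens_reflcl:
  assumes "A \<subseteq> {1..n}" "B \<subseteq> {1..n}"
    and "a \<in> lists (Gen ` rows n)" "b \<in> lists (Gen ` rows n)"
  shows "(a @ gens A @ gens B @ b, a @ gens (bump A B) @ gens (A \<union> B) @ b) \<in> (row_step n)\<^sup>="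
proof (cases "A = {} \<or> B = {}")
  case False
  define u v where "u = sorted_list_of_set A" and "v = sorted_list_of_set B"
  have uv: "u \<in> rows n" "v \<in> rows n"
    using False assms sorted_list_of_set_rows by (auto simp: u_def v_def)
  have set: "set u = A" "set v = B"
    using finite_subset[OF assms(1)] finite_subset[OF assms(2)] by (auto simp: u_def v_def)
  show ?thesis
  proof (cases "u \<triangleleft> v")
    case True
    then have "A \<subseteq> B" "bump A B = A"
      using False row_rel_iff[of u v] bump_row_rel[of A B] by (auto simp: set)
    then show ?thesis by (simp add: Un_absorb1)
  next
    case not_rel: False
    show ?thesis
      using row_step_gens[OF uv not_rel assms(3,4)] gens_row[OF uv(1)] gens_row[OF uv(2)]
      by (simp add: set)
  qed
qed auto

lemma relpow_le1_if_reflcl: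
  assumes "(x, y) \<in> R\<^sup>="
  shows "\<exists>k\<le>1. (x, y) \<in> R ^^ k"
proof (cases "x = y")
  case True
  then show ?thesis by (intro exI[of _ 0]) simp
next
  case False
  then show ?thesis using assms by (intro exI[of _ 1]) simp
qed

lemma relpow_le2_if_reflcl:
  assumes "(x, y) \<in> R\<^sup>=" "(y, z) \<in> R\<^sup>="
  shows "\<exists>k\<le>2. (x, z) \<in> R ^^ k"
proof -
  obtain i j where i: "i \<le> 1" "(x, y) \<in> R ^^ i" and j: "j \<le> 1" "(y, z) \<in> R ^^ j"
    using relpow_le1_if_reflcl[OF assms(1)] relpow_le1_if_reflcl[OF assms(2)] by blast
  have "(x, z) \<in> R ^^ (i + j)" unfolding relpow_add using i(2) j(2) by (rule relcompI)
  then show ?thesis using i(1) j(1) by (intro exI[of _ "i + j"]) simp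
qed

section \<open>The left and right branches\<close>

theorem proposition3p2p3:
  fixes n :: nat and u v t :: row
  assumes "n \<ge> 1"
    and "u \<in> rows n" and "v \<in> rows n" and "t \<in> rows n"
    and "\<not> u \<triangleleft> v" and "\<not> v \<triangleleft> t"
  shows "([Gen u, Gen v, Gen t], left_branch u v t) \<in> row_step n \<and>
    ([Gen u, Gen v, Gen t], right_branch u v t) \<in> row_step n \<and>
    (\<exists>k\<le>2. (left_branch u v t, NF u v t) \<in> row_step n ^^ k) \<and>
    (\<exists>k\<le>2. (right_branch u v t, NF u v t) \<in> row_step n ^^ k) \<and>
    length (NF u v t) \<le> 3 \<and>
    (length (N (u @ v)) = 1 \<longrightarrow> (left_branch u v t, NF u v t) \<in> row_step n ^^ 1) \<and>
    (length (N (v @ t)) = 1 \<longrightarrow>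
       (\<exists>k\<le>1. (right_branch u v t, NF u v t) \<in> row_step n ^^ k)) \<and>
    (length (N (u @ v)) = 1 \<and> length (N (v @ t)) = 1 \<longrightarrow> length (NF u v t) = 1)"
proof -
  let ?G = "lists (Gen ` rows n)"
  define U V T where "U = set u" and "V = set v" and "T = set t"
  have sub: "U \<subseteq> {1..n}" "V \<subseteq> {1..n}" "T \<subseteq> {1..n}"
    and ne: "U \<noteq> {}" "V \<noteq> {}" "T \<noteq> {}"
    using assms by (auto simp: U_def V_def T_def rows_def)
  have gens: "gens U = [Gen u]" "gens V = [Gen v]" "gens T = [Gen t]"
    using assms gens_row by (auto simp: U_def V_def T_def)
  define p q s where "p = U \<union> V" and "q = bump U V" and "s = bump V T"
  define r where "r = bump p T"
  have sub': "p \<subseteq> {1..n}" "q \<subseteq> {1..n}" "s \<subseteq> {1..n}" "r \<subseteq> {1..n}"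
    using sub bump_subset unfolding p_def q_def s_def r_def by blast+
  have Nuv: "N (u @ v) = row_word p @ row_word q" and Nvt: "N (v @ t) = row_word (V \<union> T) @ row_word s"
    using assms by (simp_all add: N_append2 rows_sorted U_def V_def T_def p_def q_def s_def)
  have left: "left_branch u v t = gens q @ gens p @ gens T"
    using assms gens
    by (simp add: left_branch_def reading_N_append2 U_def V_def p_def q_def)
  have right: "right_branch u v t = gens U @ gens s @ gens (V \<union> T)"
    using assms gens
    by (simp add: right_branch_def reading_N_append2 V_def T_def s_def)
  have NF: "NF u v t = gens (bump q r) @ gens (q \<union> r) @ gens (p \<union> T)"
    using assms reading_row_word[of _ "[]"]
    by (simp add: NF_def N_append3 rows_sorted reading_row_word U_def V_def T_def p_def q_def r_def)
  \<comment> \<open>The normal form in the shape that the right branch produces; both identities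
    enter here.\<close>
  have NF': "NF u v t = gens (bump U s) @ gens (bump (U \<union> s) (V \<union> T)) @ gens (U \<union> s \<union> (V \<union> T))"
  proof -
    have "s \<subseteq> V" using bump_subset by (simp add: s_def)
    then have "U \<union> s \<union> (V \<union> T) = p \<union> T" by (auto simp: p_def)
    then show ?thesis
      using NF bump_Un_bump[of U V T] bump_bump[of U V T] by (simp add: p_def q_def r_def s_def)
  qed
  have lists: "gens A \<in> ?G" if "A \<subseteq> {1..n}" for A using that gens_lists by blast
  have init1: "([Gen u, Gen v, Gen t], left_branch u v t) \<in> row_step n"
    using row_step_gens[OF assms(2,3,5), of "[]" "gens T"] lists[OF sub(3)] left gens
    by (simp add: U_def V_def p_def q_def)
  have init2: "([Gen u, Gen v, Gen t], right_branch u v t) \<in> row_step n"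
    using row_step_gens[OF assms(3,4,6), of "gens U" "[]"] lists[OF sub(1)] right gens
    by (simp add: T_def V_def s_def)
  define p' where "p' = sorted_list_of_set p"
  have p': "p' \<in> rows n" "set p' = p"
    using sorted_list_of_set_rows[of p n] sub' ne finite_subset[OF sub'(1)] by (auto simp: p_def p'_def)
  \<comment> \<open>As \<open>V \<subseteq> p\<close>, the relation
    \<open>p' \<triangleleft> t\<close> would imply \<open>v \<triangleleft> t\<close>. The next
    step is therefore a genuine one, as the claim of exactly one step demands.\<close>
  have "\<not> p' \<triangleleft> t"
    using assms(6) ne p'(2) row_rel_iff[of p' t] row_rel_iff[of v t]
    by (auto simp: p_def T_def V_def U_def)
  then have left1: "(left_branch u v t, gens q @ gens r @ gens (p \<union> T)) \<in> row_step n"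
    using row_step_gens[OF p'(1) assms(4), of "gens q" "[]"] lists sub' left gens gens_row[OF p'(1)] p'(2)
    by (simp add: r_def T_def)
  \<comment> \<open>From here on a step may be trivial, for instance when \<open>q\<close> or
    \<open>s\<close> is empty; hence the reflexive closure.\<close>
  have left2: "(gens q @ gens r @ gens (p \<union> T), NF u v t) \<in> (row_step n)\<^sup>="
    using row_step_gens_reflcl[of q n r "[]" "gens (p \<union> T)"] lists sub sub' NF by simp
  have right1: "(right_branch u v t, gens (bump U s) @ gens (U \<union> s) @ gens (V \<union> T)) \<in> (row_step n)\<^sup>="
    using row_step_gens_reflcl[of U n s "[]" "gens (V \<union> T)"] lists sub sub' right by simp
  have bs: "bump U s \<subseteq> {1..n}" using sub bump_subset by blast
  have right2: "(gens (bump U s) @ gens (U \<union> s) @ gens (V \<union> T), NF u v t) \<in> (row_step n)\<^sup>="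
    using row_step_gens_reflcl[of "U \<union> s" n "V \<union> T" "gens (bump U s)" "[]"] lists bs sub sub' NF'
    by simp
  have q: "q = {}" if "length (N (u @ v)) = 1"
    using that ne by (auto simp: Nuv row_word_def p_def split: if_splits)
  have s: "s = {}" if "length (N (v @ t)) = 1"
    using that ne by (auto simp: Nvt row_word_def split: if_splits)
  have "length (NF u v t) \<le> 3"
    using length_gens_le[of "bump q r"] length_gens_le[of "q \<union> r"] length_gens_le[of "p \<union> T"]
    by (simp add: NF)
  \<comment> \<open>With \<open>q\<close> empty, the word reached by \<open>left1\<close> is already
    the normal form.\<close>
  moreover have "(left_branch u v t, NF u v t) \<in> row_step n ^^ 1" if "length (N (u @ v)) = 1"
    using left1 q[OF that] NF by simp
  moreover have "\<exists>k\<le>1. (right_branch u v t, NF u v t) \<in> row_step n ^^ k"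
    if "length (N (v @ t)) = 1"
  proof (rule relpow_le1_if_reflcl)
    \<comment> \<open>With \<open>s\<close> empty, the word that \<open>right2\<close> starts from
      is the right branch itself.\<close>
    show "(right_branch u v t, NF u v t) \<in> (row_step n)\<^sup>="
      using right2 s[OF that] right by simp
  qed
  moreover have "length (NF u v t) = 1" if "length (N (u @ v)) = 1" "length (N (v @ t)) = 1"
  proof -
    have "\<forall>a\<in>U. \<forall>b\<in>V. a \<le> b" "\<forall>b\<in>V. \<forall>c\<in>T. b \<le> c"
      using q[OF that(1)] s[OF that(2)] by (simp_all add: q_def s_def bump_eq_empty_iff)
    \<comment> \<open>Any \<open>b\<close> in the nonempty \<open>V\<close> links
      \<open>a \<le> b\<close> with \<open>b \<le> c\<close>, so \<open>T\<close> bumps nothing from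
      \<open>U\<close> or from \<open>V\<close>.\<close>
    then have "r = {}"
      using ne(2) unfolding r_def p_def bump_eq_empty_iff by (blast intro: order_trans)
    then show ?thesis using NF q[OF that(1)] ne by (simp add: gens_def row_word_def)
  qed
  ultimately show ?thesis
    using init1 init2 relpow_le2_if_reflcl[OF _ left2] left1 relpow_le2_if_reflcl[OF right1 right2]
    by blast
qed

end
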